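(* For Lebesgue-almost every $t\in\mathbb R$, $B+t\subset D$, where $B$ is the set of badly approximable real numbers and $D$ is the set of diophantine real numbers.
   Context: For real $d\ge2$, $D_d$ is the set of real numbers $\alpha$ for which there is a constant $c>0$ with $|\alpha-\frac pq|>\frac c{q^d}$ for all integers $p,q$ with $q>0$. $D=\bigcup_{d\ge2}D_d$ is the set of diophantine numbers, and $B=D_2$ is the set of badly approximable numbers. *)

theory Defs
  imports "HOL-Analysis.Analysis"
begin

text \<open>The fraction \<open>p/q\<close> is not required to be in lowest terms, so rational numbers
  (for which the left-hand side vanishes for some \<open>p\<close>, \<open>q\<close>) are never diophantine.
  The definition is meant for real exponents \<open>d \<ge> 2\<close>.\<close>

definition diophantine_exp :: "real \<Rightarrow> real set" where
  "diophantine_exp d =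
    {\<alpha>. \<exists>c>0. \<forall>p q :: int. q > 0 \<longrightarrow>
      \<bar>\<alpha> - real_of_int p / real_of_int q\<bar> > c / real_of_int q powr d}"

definition diophantine :: "real set" where
  "diophantine = (\<Union>d\<in>{2..}. diophantine_exp d)"

definition badly_approximable :: "real set" where
  "badly_approximable = diophantine_exp 2"

end

theory Submission
  imports Defs
begin

text \<open>
  Fix a constant \<open>c\<close> of bad approximability. By Dirichlet's theorem every point of
  \<open>bad c\<close> has, at every scale, a nearby rational of denominator comparable to the inverse square
  root of the scale, and the neighbourhood of that rational avoided by \<open>bad c\<close> is proportional to
  the scale. So \<open>bad c\<close> is uniformly porous, its upper box dimension is less than 1, and the
  \<open>r\<close>-neighbourhood of a bounded piece has measure \<open>O(r powr \<delta>)\<close> for some \<open>\<delta> > 0\<close>.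
  A translation \<open>t\<close> that moves a point of \<open>bad c\<close> to a non-diophantine number lies, for every
  \<open>d\<close> and \<open>c0\<close>, in the \<open>c0/q^d\<close>-neighbourhood of \<open>p/q - bad c\<close> for some \<open>p/q\<close>. Taking
  \<open>d * \<delta> \<ge> 3\<close>, the measures of these sets sum to \<open>O(c0 powr \<delta>)\<close>, and \<open>c0\<close> is arbitrary.
\<close>

section \<open>Bad approximability with a fixed constant\<close>

definition bad :: "real \<Rightarrow> real set" where
  "bad c = {\<alpha>. \<forall>p q :: int. q > 0 \<longrightarrow> \<bar>\<alpha> - of_int p / of_int q\<bar> > c / (of_int q)\<^sup>2}"

lemma badD: "x \<in> bad c \<Longrightarrow> q > 0 \<Longrightarrow> \<bar>x - of_int p / of_int q\<bar> > c / (of_int q)\<^sup>2"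
  unfolding bad_def by blast

lemma diophantine_exp_2_eq: "diophantine_exp 2 = (\<Union>c\<in>{0<..}. bad c)"
  by (auto simp: diophantine_exp_def bad_def)

text \<open>Allows an arbitrary constant to be lowered to some 1/(n+1), so that countably many
  constants suffice in the end.\<close>

lemma bad_antimono:
  assumes "c' \<le> c" shows "bad c \<subseteq> bad c'"
proof
  fix x assume x: "x \<in> bad c"
  have "c' / (real_of_int q)\<^sup>2 < \<bar>x - of_int p / of_int q\<bar>" if "q > 0" for p q
    using badD[OF x that, of p] divide_right_mono[OF assms, of "(real_of_int q)\<^sup>2"] by simp
  then show "x \<in> bad c'" by (simp add: bad_def)
qed

section \<open>Uniform porosity\<close>

text \<open>The centre \<open>y\<close> is a Dirichlet approximation p/q of \<open>x\<close> with
  q^2 at most 8/(cR). Every point of \<open>bad c\<close> has distance more than c/q^2 from it,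
  which is at least c^2 R/8.\<close>

lemma bad_hole:
  assumes x: "x \<in> bad c" and c: "0 < c" "c \<le> 1" and R: "0 < R" "R \<le> 1"
  obtains y where "\<bar>y - x\<bar> \<le> R / 2" "\<And>b. b \<in> bad c \<Longrightarrow> c\<^sup>2 * R / 8 < \<bar>b - y\<bar>"
proof -
  \<comment> \<open>Chosen so that the later bound |x - y| < 1/(c Q^2), with Q at least
    \<open>s\<close>, yields |x - y| < R/2.\<close>
  define s where "s = sqrt (2 / (c * R))"
  have cR: "0 < c * R" "c * R \<le> 1" using c R by (auto simp: mult_le_one)
  have s2: "s\<^sup>2 = 2 / (c * R)" using cR by (simp add: s_def)
  have s1: "1 \<le> s" unfolding s_def using cR by simp
  define Q where "Q = nat \<lceil>s\<rceil>"
  \<comment> \<open>Rounding up at most doubles \<open>s\<close> because \<open>s\<close> is at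
    least 1; the upper bound on \<open>Q\<close> controls the size of the hole.\<close>
  have Q: "s \<le> real Q" "real Q \<le> 2 * s" "Q > 0"
    using s1 unfolding Q_def by linarith+
  have Q1: "2 / (c * R) \<le> (real Q)\<^sup>2"
    using power_mono[OF Q(1), of 2] s1 s2 by simp
  have Q2: "(real Q)\<^sup>2 \<le> 8 / (c * R)"
    using power_mono[OF Q(2), of 2] s2 by (simp add: power_mult_distrib)
  obtain p q where q: "0 < q" "q \<le> int Q" and pq: "\<bar>of_int q * x - of_int p\<bar> < 1 / real Q"
    using Dirichlet_approx[OF Q(3), of x] by metis
  define y where "y = real_of_int p / of_int q"
  have qpos: "0 < real_of_int q" using q by simp
  have qQ: "real_of_int q \<le> real Q" using q(2) by linarith
  have "of_int q * x - of_int p = real_of_int q * (x - y)"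
    using qpos by (simp add: y_def right_diff_distrib)
  then have "real_of_int q * \<bar>x - y\<bar> = \<bar>of_int q * x - of_int p\<bar>"
    using qpos by (simp add: abs_mult)
  then have d1: "real_of_int q * \<bar>x - y\<bar> < 1 / real Q" using pq by simp
  have d2: "c / (of_int q)\<^sup>2 < \<bar>x - y\<bar>" using badD[OF x q(1)] by (simp add: y_def)
  \<comment> \<open>Since \<open>x\<close> is badly approximable, the Dirichlet denominator \<open>q\<close> cannot be much smaller than \<open>Q\<close>.\<close>
  have "c / of_int q < of_int q * \<bar>x - y\<bar>"
    using d2 qpos by (simp add: field_simps power2_eq_square)
  then have "c / of_int q < 1 / real Q" using d1 by simp
  then have cQ: "c * real Q < of_int q" using qpos Q(3) by (simp add: field_simps)
  \<comment> \<open>Replacing the factor \<open>q\<close> in \<open>d1\<close> by the smaller c Q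
    gives |x - y| < 1/(c Q^2).\<close>
  have "c * real Q * \<bar>x - y\<bar> \<le> of_int q * \<bar>x - y\<bar>"
    by (rule mult_right_mono) (use cQ in auto)
  then have "c * real Q * \<bar>x - y\<bar> < 1 / real Q" using d1 by linarith
  then have d3: "\<bar>x - y\<bar> * (real Q)\<^sup>2 < 1 / c"
    using c Q(3) by (simp add: field_simps power2_eq_square)
  have "\<bar>x - y\<bar> * (2 / (c * R)) \<le> \<bar>x - y\<bar> * (real Q)\<^sup>2"
    by (rule mult_left_mono[OF Q1]) simp
  then have "\<bar>x - y\<bar> * (2 / (c * R)) < 1 / c" using d3 by linarith
  then have "\<bar>x - y\<bar> < R / 2" using c R by (simp add: field_simps)
  then have near: "\<bar>y - x\<bar> \<le> R / 2" by linarith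
  have "c\<^sup>2 * R / 8 < \<bar>b - y\<bar>" if "b \<in> bad c" for b
  proof -
    have "(of_int q)\<^sup>2 \<le> (real Q)\<^sup>2" using power_mono[OF qQ, of 2] qpos by simp
    then have "(of_int q)\<^sup>2 \<le> 8 / (c * R)" using Q2 by linarith
    then have "c\<^sup>2 * R / 8 \<le> c / (of_int q)\<^sup>2"
      using qpos c R by (simp add: field_simps power2_eq_square)
    then show ?thesis using badD[OF that q(1), of p] unfolding y_def by linarith
  qed
  with near show ?thesis by (rule that)
qed

lemma bad_misses_piece:
  assumes c: "0 < c" "c \<le> 1" and N: "24 \<le> c\<^sup>2 * real N" and l: "0 < l" "l \<le> 1"
  shows "\<exists>i<N. \<forall>b\<in>bad c. \<not> (a + real i * (l / N) \<le> b \<and> b < a + (real i + 1) * (l / N))"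
  \<comment> \<open>Either the central piece is missed, or it contains a point of \<open>bad c\<close>, and the hole near
    that point is long enough to contain a piece.\<close>
proof (cases "\<exists>x\<in>bad c. a + real (N div 2) * (l / N) \<le> x \<and> x < a + (real (N div 2) + 1) * (l / N)")
  case False
  have "c\<^sup>2 * real N \<le> 1 * real N" using c by (intro mult_right_mono) (auto simp: power_le_one)
  then have "N div 2 < N" using N by simp
  then show ?thesis using False by blast
next
  case True
  then obtain x where x: "x \<in> bad c"
    and x1: "a + real (N div 2) * (l / N) \<le> x" and x2: "x < a + (real (N div 2) + 1) * (l / N)"
    by blast
  have "c\<^sup>2 * real N \<le> 1 * real N" using c by (intro mult_right_mono) (auto simp: power_le_one)
  then have N24: "24 \<le> real N" using N by simp
  define h where "h = l / N"
  have hN: "h * real N = l" using N24 by (simp add: h_def)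
  have h0: "0 < h" using l N24 by (simp add: h_def)
  have h24: "24 * h \<le> l" using mult_left_mono[OF N24, of h] h0 hN by (simp add: mult.commute)
  have half: "real (N div 2) \<le> real N / 2" "real N / 2 \<le> real (N div 2) + 1"
    by linarith+
  have "real (N div 2) * h \<le> l / 2" "l / 2 \<le> (real (N div 2) + 1) * h"
    using mult_right_mono[OF half(1), of h] mult_right_mono[OF half(2), of h] h0 hN
    by (auto simp: mult.commute)
  then have xm: "\<bar>x - (a + l / 2)\<bar> \<le> h"
    using x1 x2 unfolding h_def[symmetric] abs_le_iff by (simp add: algebra_simps)
  \<comment> \<open>At scale l/3 the centre \<open>y\<close> is within l/6 of \<open>x\<close>,
    which is within h \<le> l/24 of the midpoint, so \<open>y\<close> stays inside the interval. The
    radius of the hole is c^2 l/24, at least \<open>h\<close> by the assumption on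
    \<open>N\<close>.\<close>
  obtain y where y: "\<bar>y - x\<bar> \<le> (l / 3) / 2"
    and hole: "\<And>b. b \<in> bad c \<Longrightarrow> c\<^sup>2 * (l / 3) / 8 < \<bar>b - y\<bar>"
    using bad_hole[OF x c, of "l / 3"] l by auto
  have big: "h \<le> c\<^sup>2 * (l / 3) / 8"
    using mult_right_mono[OF N, of h] h0 hN by (simp add: mult.assoc mult.commute[of "real N"])
  have ya: "0 < y - a" "y - a < l" using xm y h24 l by linarith+
  \<comment> \<open>The piece containing \<open>y\<close> has length \<open>h\<close>, so it lies
    inside the hole.\<close>
  define i where "i = nat \<lfloor>(y - a) / h\<rfloor>"
  have q0: "0 \<le> (y - a) / h" using ya h0 by simp
  have i1: "real i \<le> (y - a) / h" and i2: "(y - a) / h < real i + 1"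
    using q0 unfolding i_def by linarith+
  have "(y - a) / h < real N" using ya h0 hN by (simp add: pos_divide_less_eq mult.commute)
  then have iN: "i < N" using i1 by simp
  have i1': "real i * h \<le> y - a" and i2': "y - a < (real i + 1) * h"
    using i1 i2 h0 by (auto simp: pos_le_divide_eq pos_divide_less_eq)
  have "\<not> (a + real i * h \<le> b \<and> b < a + (real i + 1) * h)" if "b \<in> bad c" for b
  proof
    assume "a + real i * h \<le> b \<and> b < a + (real i + 1) * h"
    then have "\<bar>b - y\<bar> \<le> h" using i1' i2' by (simp add: algebra_simps abs_le_iff)
    then show False using hole[OF that] big by linarith
  qed
  then show ?thesis using iN unfolding h_def by blast
qed

section \<open>Counting grid cells and covering\<close>

text \<open>The cells of the \<open>N\<close>-adic grid on [-K, K) are encoded by integers so that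
  passing to the parent cell is \<open>div\<close> by \<open>N\<close>; half-open cells make the
  cell of a point unique.\<close>

definition pieces :: "real \<Rightarrow> nat \<Rightarrow> nat \<Rightarrow> nat \<Rightarrow> int set" where
  "pieces c K N k = {j. - int K * int N ^ k \<le> j \<and> j < int K * int N ^ k \<and>
     (\<exists>b\<in>bad c. real_of_int j / real N ^ k \<le> b \<and> b < (real_of_int j + 1) / real N ^ k)}"

lemma finite_pieces: "finite (pieces c K N k)"
  by (rule finite_subset[of _ "{- int K * int N ^ k ..< int K * int N ^ k}"])
     (auto simp: pieces_def)

text \<open>By \<open>bad_misses_piece\<close> each cell has a child that misses
  \<open>bad c\<close>, so a refinement multiplies the count by at most N - 1 instead of N.\<close>

lemma card_pieces_le:
  assumes c: "0 < c" "c \<le> 1" and N: "24 \<le> c\<^sup>2 * real N"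
  shows "card (pieces c K N k) \<le> 2 * K * (N - 1) ^ k"
proof (induction k)
  case 0
  have "card (pieces c K N 0) \<le> card {- int K ..< int K}"
    by (rule card_mono) (auto simp: pieces_def)
  then show ?case by simp
next
  case (Suc k)
  have N0: "N > 0" using N by (cases N) auto
  have "\<exists>i<N. \<forall>b\<in>bad c. \<not> (real_of_int j / real N ^ k + real i * (1 / real N ^ k / N) \<le> b
      \<and> b < real_of_int j / real N ^ k + (real i + 1) * (1 / real N ^ k / N))" for j
    by (rule bad_misses_piece[OF c N]) (use N0 in auto)
  then obtain f where fN: "\<And>j. f j < N"
    and f: "\<And>j b. b \<in> bad c \<Longrightarrow> \<not> (real_of_int j / real N ^ k + real (f j) * (1 / real N ^ k / N) \<le> b
      \<and> b < real_of_int j / real N ^ k + (real (f j) + 1) * (1 / real N ^ k / N))"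
    by metis
  have "pieces c K N (Suc k) \<subseteq>
    (\<Union>j\<in>pieces c K N k. (\<lambda>i. int N * j + int i) ` ({..<N} - {f j}))"
  proof
    fix j' assume "j' \<in> pieces c K N (Suc k)"
    then obtain b where j': "- int K * int N ^ Suc k \<le> j'" "j' < int K * int N ^ Suc k"
      and b: "b \<in> bad c" "real_of_int j' / real N ^ Suc k \<le> b" "b < (real_of_int j' + 1) / real N ^ Suc k"
      by (auto simp: pieces_def)
    \<comment> \<open>The quotient is the parent cell, the remainder the position of the child in
      it.\<close>
    define j where "j = j' div int N"
    define i where "i = nat (j' mod int N)"
    have ii: "int i = j' mod int N" "i < N" using N0 by (auto simp: i_def nat_less_iff)
    have jj: "j' = int N * j + int i" by (simp add: ii j_def)
    then have jr: "real_of_int j' = real N * real_of_int j + real i" by simp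
    have split: "real_of_int j' / real N ^ Suc k = real_of_int j / real N ^ k + real i * (1 / real N ^ k / N)"
      "(real_of_int j' + 1) / real N ^ Suc k = real_of_int j / real N ^ k + (real i + 1) * (1 / real N ^ k / N)"
      using N0 by (auto simp: jr field_simps)
    have "i \<noteq> f j" using f[OF b(1), of j] b split by auto
    moreover have "j \<in> pieces c K N k"
    proof -
      have "(- int K * int N ^ k) * int N div int N \<le> j"
        unfolding j_def using N0 j'(1) by (intro zdiv_mono1) (auto simp: ac_simps)
      moreover have "(- int K * int N ^ k) * int N div int N = - int K * int N ^ k"
        by (rule nonzero_mult_div_cancel_right) (use N0 in simp)
      ultimately have lo: "- int K * int N ^ k \<le> j" by (simp only:)
      have "j * int N \<le> j'" using jj by (simp add: mult.commute)
      then have "j * int N < (int K * int N ^ k) * int N" using j'(2) by (simp add: ac_simps)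
      then have hi: "j < int K * int N ^ k" using N0 by simp
      \<comment> \<open>The child lies within its parent, so the same \<open>b\<close> shows that
        the parent meets \<open>bad c\<close>.\<close>
      have "0 \<le> real i * (1 / real N ^ k / N)" by simp
      moreover have "(real i + 1) * (1 / real N ^ k / N) \<le> real N * (1 / real N ^ k / N)"
        by (rule mult_right_mono) (use ii in auto)
      moreover have "real N * (1 / real N ^ k / N) = 1 / real N ^ k" using N0 by simp
      ultimately have "real_of_int j / real N ^ k \<le> b" "b < (real_of_int j + 1) / real N ^ k"
        using b(2,3)[unfolded split] unfolding add_divide_distrib by linarith+
      then show ?thesis using lo hi b(1) unfolding pieces_def by blast
    qed
    ultimately show "j' \<in> (\<Union>j\<in>pieces c K N k. (\<lambda>i. int N * j + int i) ` ({..<N} - {f j}))"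
      using ii jj by blast
  qed
  then have "card (pieces c K N (Suc k)) \<le>
      card (\<Union>j\<in>pieces c K N k. (\<lambda>i. int N * j + int i) ` ({..<N} - {f j}))"
    by (intro card_mono) (auto simp: finite_pieces)
  also have "\<dots> \<le> (\<Sum>j\<in>pieces c K N k. card ((\<lambda>i. int N * j + int i) ` ({..<N} - {f j})))"
    by (rule card_UN_le[OF finite_pieces])
  also have "\<dots> \<le> (\<Sum>j\<in>pieces c K N k. N - 1)"
    by (intro sum_mono order.trans[OF card_image_le]) (use fN in auto)
  also have "\<dots> \<le> 2 * K * (N - 1) ^ Suc k"
    using mult_right_mono[OF Suc, of "N - 1"] by (simp add: ac_simps)
  finally show ?case .
qed

text \<open>The grid of level \<open>k\<close> with cell length comparable to \<open>r\<close> is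
  used: about (N-1)^k cells of length N^(-k) have total length of order ((N-1)/N)^k, a positive
  power of \<open>r\<close>. The constants are fixed before \<open>r\<close>.\<close>

lemma bad_cover:
  assumes c: "0 < c" "c \<le> 1"
  obtains C \<delta> :: real where "C \<ge> 0" "\<delta> > 0"
    "\<And>r. 0 < r \<Longrightarrow> r \<le> 1 \<Longrightarrow> \<exists>F \<rho>. finite F \<and> 0 \<le> \<rho> \<and> real (card F) * \<rho> \<le> C * r powr \<delta> \<and>
       (\<forall>b\<in>bad c. \<forall>x. - real K \<le> b \<longrightarrow> b < real K \<longrightarrow> \<bar>x - b\<bar> \<le> r \<longrightarrow> (\<exists>f\<in>F. \<bar>x - f\<bar> \<le> \<rho>))"
proof -
  define N where "N = nat \<lceil>24 / c\<^sup>2\<rceil>"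
  have "24 / c\<^sup>2 \<le> real N" unfolding N_def by linarith
  then have N: "24 \<le> c\<^sup>2 * real N" using c by (simp add: field_simps)
  have "c\<^sup>2 * real N \<le> 1 * real N" using c by (intro mult_right_mono) (auto simp: power_le_one)
  then have N24: "24 \<le> real N" using N by simp
  define \<theta> where "\<theta> = (real N - 1) / real N"
  have th: "0 < \<theta>" "\<theta> < 1" using N24 by (auto simp: \<theta>_def)
  \<comment> \<open>This is 1 - log_N (N-1), the gap between 1 and the dimension bound.\<close>
  define \<delta> where "\<delta> = - log N \<theta>"
  have d0: "0 < \<delta>" using th N24 by (simp add: \<delta>_def)
  have thN: "\<theta> = real N powr (- \<delta>)" using th N24 by (simp add: \<delta>_def)
  have main: "\<exists>F \<rho>. finite F \<and> 0 \<le> \<rho> \<and> real (card F) * \<rho> \<le> (4 * real K * real N powr \<delta>) * r powr \<delta> \<and>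
       (\<forall>b\<in>bad c. \<forall>x. - real K \<le> b \<longrightarrow> b < real K \<longrightarrow> \<bar>x - b\<bar> \<le> r \<longrightarrow> (\<exists>f\<in>F. \<bar>x - f\<bar> \<le> \<rho>))"
    if r: "0 < r" "r \<le> 1" for r
  proof -
    define L where "L = log N (1 / r)"
    have L0: "0 \<le> L" using r N24 by (simp add: L_def)
    have NL: "real N powr L = 1 / r" using r N24 by (simp add: L_def)
    \<comment> \<open>The level for which N^(-k-1) \<le> r \<le> N^(-k).\<close>
    define k where "k = nat \<lfloor>L\<rfloor>"
    have k: "real k \<le> L" "L \<le> real k + 1" using L0 unfolding k_def by linarith+
    have Nk: "real N ^ k = real N powr real k" using N24 by (simp add: powr_realpow)
    have "real N ^ k \<le> 1 / r" unfolding Nk NL[symmetric] using k N24 by (intro powr_mono) auto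
    then have rk: "r \<le> 1 / real N ^ k" using r N24 by (simp add: field_simps)
    have "1 / r \<le> real N powr (real k + 1)" unfolding NL[symmetric] using k N24 by (intro powr_mono) auto
    also have "\<dots> = real N ^ k * real N" using N24 by (simp add: Nk powr_add)
    finally have kr: "1 / real N ^ k \<le> real N * r" using r N24 by (simp add: field_simps)
    define F where "F = (\<lambda>j. real_of_int j / real N ^ k) ` pieces c K N k"
    have N1: "real (N - 1) = real N - 1" using N24 by simp
    have "card F \<le> 2 * K * (N - 1) ^ k"
      unfolding F_def using card_image_le[OF finite_pieces] card_pieces_le[OF c N] order.trans by blast
    then have "real (card F) \<le> real (2 * K * (N - 1) ^ k)" by linarith
    then have "real (card F) \<le> 2 * real K * (real N - 1) ^ k" by (simp only: of_nat_mult of_nat_power of_nat_numeral N1)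
    then have "real (card F) * (2 / real N ^ k) \<le> (2 * real K * (real N - 1) ^ k) * (2 / real N ^ k)"
      by (rule mult_right_mono) simp
    also have "\<dots> = 4 * real K * \<theta> ^ k" by (simp add: \<theta>_def power_divide)
    finally have cF: "real (card F) * (2 / real N ^ k) \<le> 4 * real K * \<theta> ^ k" .
    have "\<theta> ^ k = (1 / real N ^ k) powr \<delta>"
      using th N24 by (simp add: Nk powr_realpow[symmetric] thN powr_powr powr_divide powr_minus_divide mult.commute)
    also have "\<dots> \<le> (real N * r) powr \<delta>"
      using kr d0 N24 by (intro powr_mono2) auto
    also have "\<dots> = real N powr \<delta> * r powr \<delta>" using r by (simp add: powr_mult)
    finally have "4 * real K * \<theta> ^ k \<le> 4 * real K * (real N powr \<delta> * r powr \<delta>)"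
      by (intro mult_left_mono) auto
    with cF have "real (card F) * (2 / real N ^ k) \<le> 4 * real K * (real N powr \<delta> * r powr \<delta>)"
      by (rule order.trans)
    then have est: "real (card F) * (2 / real N ^ k) \<le> (4 * real K * real N powr \<delta>) * r powr \<delta>"
      by (simp only: mult.assoc)
    have "\<exists>f\<in>F. \<bar>x - f\<bar> \<le> 2 / real N ^ k"
      if b: "b \<in> bad c" "- real K \<le> b" "b < real K" "\<bar>x - b\<bar> \<le> r" for b x
    proof -
      define j where "j = \<lfloor>b * real N ^ k\<rfloor>"
      have Nk0: "0 < real N ^ k" using N24 by simp
      have j: "real_of_int j \<le> b * real N ^ k" "b * real N ^ k < real_of_int j + 1"
        unfolding j_def by linarith+
      have j': "real_of_int j / real N ^ k \<le> b" "b < (real_of_int j + 1) / real N ^ k"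
        using j Nk0 by (auto simp: field_simps)
      have "real_of_int (- int K * int N ^ k) \<le> b * real N ^ k"
        using mult_right_mono[OF b(2), of "real N ^ k"] by simp
      then have lo: "- int K * int N ^ k \<le> j" unfolding j_def by (rule iffD2[OF le_floor_iff])
      have "b * real N ^ k < real_of_int (int K * int N ^ k)"
        using mult_strict_right_mono[OF b(3) Nk0] by simp
      then have hi: "j < int K * int N ^ k" unfolding j_def by (rule iffD2[OF floor_less_iff])
      have "j \<in> pieces c K N k" unfolding pieces_def using lo hi j' b(1) by blast
      then have "real_of_int j / real N ^ k \<in> F" unfolding F_def by blast
      moreover have "\<bar>x - real_of_int j / real N ^ k\<bar> \<le> 2 / real N ^ k"
      proof -
        \<comment> \<open>One cell length leads from the left endpoint to \<open>b\<close>, and a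
          second one dominates \<open>r\<close>; hence the radius 2/N^k.\<close>
        have "b - real_of_int j / real N ^ k \<le> 1 / real N ^ k"
          using j'(2) unfolding add_divide_distrib by linarith
        moreover have "2 / real N ^ k = 1 / real N ^ k + 1 / real N ^ k" by simp
        ultimately show ?thesis using j'(1) b(4) rk by linarith
      qed
      ultimately show ?thesis by blast
    qed
    moreover have "finite F" unfolding F_def by (simp add: finite_pieces)
    ultimately show ?thesis using est by (intro exI[of _ F] exI[of _ "2 / real N ^ k"]) auto
  qed
  show ?thesis
    by (rule that[OF _ d0 main]) auto
qed

section \<open>Measure of the exceptional translations\<close>

lemma negligible_translates_bad:
  assumes c: "0 < c" "c \<le> 1"
  shows "negligible {t. \<exists>b\<in>bad c. - real K \<le> b \<and> b < real K \<and> \<bar>b + t\<bar> \<le> real K \<and> b + t \<notin> diophantine}"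
    (is "negligible ?S")
proof -
  obtain C \<delta> :: real where C: "C \<ge> 0" and \<delta>: "\<delta> > 0"
    and cover: "\<And>r. 0 < r \<Longrightarrow> r \<le> 1 \<Longrightarrow> \<exists>F \<rho>. finite F \<and> 0 \<le> \<rho> \<and> real (card F) * \<rho> \<le> C * r powr \<delta> \<and>
       (\<forall>b\<in>bad c. \<forall>x. - real K \<le> b \<longrightarrow> b < real K \<longrightarrow> \<bar>x - b\<bar> \<le> r \<longrightarrow> (\<exists>f\<in>F. \<bar>x - f\<bar> \<le> \<rho>))"
    using bad_cover[OF c, where K=K] by metis
  \<comment> \<open>O(q) numerators, each contributing O(q^(-d \<delta>)), then give the summable
    q^(-2). The maximum keeps \<open>d\<close> among the exponents in
    \<open>diophantine\<close>.\<close>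
  define d where "d = max 2 (3 / \<delta>)"
  have d2: "2 \<le> d" by (simp add: d_def)
  have "3 / \<delta> \<le> d" by (simp add: d_def)
  then have d3: "3 \<le> d * \<delta>" using \<delta> by (simp add: field_simps)
  define Z where "Z = (\<Sum>n. 1 / (real (Suc n))\<^sup>2)"
  have sumZ: "summable (\<lambda>n. 1 / (real (Suc n))\<^sup>2)"
    using inverse_power_summable[of 2, where 'a=real] 
    by (subst summable_Suc_iff[of "\<lambda>n. 1 / (real n)\<^sup>2"]) (simp add: field_simps)
  have Z0: "0 \<le> Z" unfolding Z_def by (intro suminf_nonneg sumZ) auto
  define A where "A = 2 * real (2 * K + 3) * C"
  have A0: "0 \<le> A" using C by (simp add: A_def)
  show ?thesis
    unfolding negligible_outer_le
  proof (intro allI impI)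
    fix e :: real assume e: "0 < e"
    \<comment> \<open>Makes the total measure A c0^\<delta> Z at most \<open>e\<close>. The summand
      1 keeps the denominator positive, and c0 \<le> 1 keeps the radii \<open>r n\<close> in the
      range of \<open>cover\<close>.\<close>
    define c0 where "c0 = min 1 ((e / (A * Z + 1)) powr (1 / \<delta>))"
    have AZ: "0 < A * Z + 1" using A0 Z0 by (simp add: add_nonneg_pos)
    have c0: "0 < c0" "c0 \<le> 1" using e AZ by (auto simp: c0_def)
    have "c0 powr \<delta> \<le> ((e / (A * Z + 1)) powr (1 / \<delta>)) powr \<delta>"
      using \<delta> c0 by (intro powr_mono2) (auto simp: c0_def)
    also have "\<dots> = e / (A * Z + 1)" using \<delta> e AZ by (simp add: powr_powr)
    finally have "c0 powr \<delta> * (A * Z + 1) \<le> e" using AZ by (simp add: pos_le_divide_eq)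
    moreover have "A * c0 powr \<delta> * Z \<le> c0 powr \<delta> * (A * Z + 1)" by (simp add: algebra_simps)
    ultimately have c0e: "A * c0 powr \<delta> * Z \<le> e" by linarith
    \<comment> \<open>The index \<open>n\<close> stands for the denominator n + 1.\<close>
    define r where "r n = c0 / real (Suc n) powr d" for n
    have Sd: "1 \<le> real (Suc n) powr d" for n
      using d2 by (intro ge_one_powr_ge_zero) auto
    have r: "0 < r n" "r n \<le> 1" for n
      using c0 Sd[of n] by (auto simp: r_def divide_le_eq_1 intro: order.trans)
    obtain F \<rho> where F: "\<And>n. finite (F n)" and \<rho>: "\<And>n. 0 \<le> \<rho> n"
      and bound: "\<And>n. real (card (F n)) * \<rho> n \<le> C * r n powr \<delta>"
      and cov: "\<And>n b x. b \<in> bad c \<Longrightarrow> - real K \<le> b \<Longrightarrow> b < real K \<Longrightarrow> \<bar>x - b\<bar> \<le> r n \<Longrightarrow>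
          \<exists>f\<in>F n. \<bar>x - f\<bar> \<le> \<rho> n"
      using cover[OF r] by metis
    \<comment> \<open>Contains every relevant numerator: |p/q| \<le> |b + t| + r n \<le> K +
      1.\<close>
    define P where "P n = {- int ((K + 1) * Suc n) .. int ((K + 1) * Suc n)}" for n
    have cardP: "card (P n) \<le> (2 * K + 3) * Suc n" for n
    proof -
      have "card {- int m .. int m} = 2 * m + 1" for m by simp
      then have "card (P n) = 2 * ((K + 1) * Suc n) + 1" unfolding P_def .
      then show ?thesis by (simp add: algebra_simps)
    qed
    define T where "T n = (\<Union>(p,f)\<in>P n \<times> F n. cball (real_of_int p / real (Suc n) - f) (\<rho> n))" for n
    have Tm: "T n \<in> sets lborel" for n
      unfolding T_def using F by (intro sets.finite_UN) (auto simp: P_def)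
    have Te: "emeasure lborel (T n) \<le> ennreal (A * c0 powr \<delta> * (1 / (real (Suc n))\<^sup>2))" for n
    proof -
      have "emeasure lborel (T n) \<le>
          (\<Sum>(p,f)\<in>P n \<times> F n. emeasure lborel (cball (real_of_int p / real (Suc n) - f) (\<rho> n)))"
        unfolding T_def case_prod_unfold using F
        by (intro emeasure_subadditive_finite) (auto simp: P_def)
      also have "\<dots> = (\<Sum>(p,f)\<in>P n \<times> F n. ennreal (2 * \<rho> n))"
        using \<rho>[of n] by (intro sum.cong) (auto simp: cball_eq_atLeastAtMost)
      also have "\<dots> = ennreal (real (card (P n)) * (2 * (real (card (F n)) * \<rho> n)))"
        using \<rho>[of n] by (simp add: card_cartesian_product ennreal_of_nat_eq_real_of_nat case_prod_unfold
            ac_simps flip: ennreal_mult)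
      also have "\<dots> \<le> ennreal ((real (2 * K + 3) * real (Suc n)) * (2 * (C * r n powr \<delta>)))"
      proof (rule ennreal_leI, rule mult_mono)
        show "real (card (P n)) \<le> real (2 * K + 3) * real (Suc n)"
          using cardP[of n] by (metis of_nat_le_iff of_nat_mult)
        show "2 * (real (card (F n)) * \<rho> n) \<le> 2 * (C * r n powr \<delta>)" using bound[of n] by simp
      qed (use \<rho>[of n] in auto)
      also have "(real (2 * K + 3) * real (Suc n)) * (2 * (C * r n powr \<delta>)) =
          A * c0 powr \<delta> * (real (Suc n) / real (Suc n) powr (d * \<delta>))"
        using c0 by (simp add: r_def A_def powr_divide powr_powr del: of_nat_Suc of_nat_add of_nat_mult)
      also have "\<dots> \<le> A * c0 powr \<delta> * (1 / (real (Suc n))\<^sup>2)"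
      proof (intro mult_left_mono)
        have "real (Suc n) powr 3 \<le> real (Suc n) powr (d * \<delta>)" using d3 by (intro powr_mono) auto
        then have "real (Suc n) ^ 3 \<le> real (Suc n) powr (d * \<delta>)" by simp
        then show "real (Suc n) / real (Suc n) powr (d * \<delta>) \<le> 1 / (real (Suc n))\<^sup>2"
          by (simp add: divide_simps power2_eq_square power3_eq_cube del: of_nat_Suc)
      qed (use A0 in auto)
      finally show ?thesis by (simp add: ennreal_leI)
    qed
    have "emeasure lborel (\<Union>n. T n) \<le> (\<Sum>n. emeasure lborel (T n))"
      using Tm by (intro emeasure_subadditive_countably) auto
    also have "\<dots> \<le> (\<Sum>n. ennreal (A * c0 powr \<delta> * (1 / (real (Suc n))\<^sup>2)))"
      using Te by (intro suminf_le) auto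
    also have "\<dots> = ennreal (\<Sum>n. A * c0 powr \<delta> * (1 / (real (Suc n))\<^sup>2))"
      using A0 by (intro suminf_ennreal2 summable_mult sumZ) auto
    also have "(\<Sum>n. A * c0 powr \<delta> * (1 / (real (Suc n))\<^sup>2)) = A * c0 powr \<delta> * Z"
      unfolding Z_def by (rule suminf_mult[OF sumZ])
    also have "ennreal \<dots> \<le> ennreal e" using c0e by (rule ennreal_leI)
    finally have me: "emeasure lborel (\<Union>n. T n) \<le> ennreal e" .
    have Um: "(\<Union>n. T n) \<in> sets lborel" using Tm by blast
    have me': "emeasure lebesgue (\<Union>n. T n) \<le> ennreal e" using me Um by (simp add: emeasure_completion)
    have Um': "(\<Union>n. T n) \<in> sets lebesgue" using Um by (simp add: sets_completionI_sets)
    have fm: "(\<Union>n. T n) \<in> lmeasurable"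
      using me' Um' by (intro fmeasurableI) (auto simp: order.strict_trans1)
    have ml: "measure lebesgue (\<Union>n. T n) \<le> e"
      using me' e unfolding measure_def by (simp add: enn2real_leI)
    have "?S \<subseteq> (\<Union>n. T n)"
    proof
      fix t assume "t \<in> ?S"
      then obtain b where b: "b \<in> bad c" "- real K \<le> b" "b < real K"
        and bt: "\<bar>b + t\<bar> \<le> real K" "b + t \<notin> diophantine" by blast
      have "b + t \<notin> diophantine_exp d" using bt(2) d2 by (auto simp: diophantine_def)
      then have "\<not> (\<forall>p q :: int. q > 0 \<longrightarrow> \<bar>b + t - of_int p / of_int q\<bar> > c0 / of_int q powr d)"
        using c0(1) unfolding diophantine_exp_def by blast
      then obtain p q :: int where q: "q > 0"
        and pq: "\<bar>b + t - of_int p / of_int q\<bar> \<le> c0 / of_int q powr d"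
        by (auto simp: not_less)
      obtain n where n: "q = int (Suc n)" using q by (metis gr0_implies_Suc zero_less_imp_eq_int)
      have qn: "real_of_int q = real (Suc n)" by (simp add: n)
      have close: "\<bar>b + t - of_int p / real (Suc n)\<bar> \<le> r n" using pq unfolding r_def qn .
      \<comment> \<open>Read as closeness of p/q - t to \<open>b\<close>, the estimate meets a cover
        of \<open>bad c\<close> that does not depend on \<open>t\<close>.\<close>
      have "\<bar>(of_int p / real (Suc n) - t) - b\<bar> \<le> r n" using close by linarith
      then obtain f where f: "f \<in> F n" "\<bar>(of_int p / real (Suc n) - t) - f\<bar> \<le> \<rho> n"
        using cov[OF b] by blast
      have "\<bar>of_int p / real (Suc n)\<bar> \<le> real K + 1" using close bt(1) r(2)[of n] by linarith
      then have "\<bar>real_of_int p\<bar> \<le> (real K + 1) * real (Suc n)" by (simp add: pos_divide_le_eq del: of_nat_Suc)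
      then have "real_of_int \<bar>p\<bar> \<le> real_of_int (int ((K + 1) * Suc n))" by (simp add: algebra_simps)
      then have "p \<in> P n" unfolding P_def of_int_le_iff by auto
      moreover have "t \<in> cball (real_of_int p / real (Suc n) - f) (\<rho> n)"
        using f(2) unfolding mem_cball dist_real_def by linarith
      ultimately show "t \<in> (\<Union>n. T n)" unfolding T_def using f(1) by blast
    qed
    then show "\<exists>T. ?S \<subseteq> T \<and> T \<in> lmeasurable \<and> measure lebesgue T \<le> e"
      using fm ml by blast
  qed
qed

theorem corollary0p7:
  shows "AE t in lebesgue. (\<lambda>b. b + t) ` badly_approximable \<subseteq> diophantine"
proof -
  \<comment> \<open>Letting \<open>n\<close> and \<open>K\<close> run through the naturals reaches
    every constant of bad approximability and every size of b and b + t, at the cost of only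
    countably many null sets.\<close>
  define S where "S n K = {t. \<exists>b\<in>bad (1 / real (Suc n)). - real K \<le> b \<and> b < real K \<and>
    \<bar>b + t\<bar> \<le> real K \<and> b + t \<notin> diophantine}" for n K
  have "negligible (S n K)" for n K
    unfolding S_def by (rule negligible_translates_bad) auto
  then have null: "(\<Union>n. \<Union>K. S n K) \<in> null_sets lebesgue"
    by (intro null_sets_UN) (auto simp: negligible_iff_null_sets)
  have "{t. \<not> (\<lambda>b. b + t) ` badly_approximable \<subseteq> diophantine} \<subseteq> (\<Union>n. \<Union>K. S n K)"
  proof
    fix t assume "t \<in> {t. \<not> (\<lambda>b. b + t) ` badly_approximable \<subseteq> diophantine}"
    then obtain b c where b: "b + t \<notin> diophantine" and c: "c > 0" "b \<in> bad c"
      unfolding badly_approximable_def diophantine_exp_2_eq by auto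
    obtain n where "inverse (real (Suc n)) < c" using reals_Archimedean[OF c(1)] by blast
    then have bn: "b \<in> bad (1 / real (Suc n))"
      using c(2) bad_antimono[of "1 / real (Suc n)" c] by (auto simp: inverse_eq_divide)
    obtain K :: nat where "\<bar>b\<bar> + \<bar>b + t\<bar> < real K" using reals_Archimedean2 by blast
    then have "- real K \<le> b" "b < real K" "\<bar>b + t\<bar> \<le> real K" by linarith+
    then have "t \<in> S n K" unfolding S_def using bn b by blast
    then show "t \<in> (\<Union>n. \<Union>K. S n K)" by blast
  qed
  then show ?thesis by (intro AE_I'[OF null]) auto
qed

end
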